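(* Let $p/q$ be a rational number in lowest terms, let $m\ge 0$ be an integer, and let $(u_n)_{n\ge1}$ be an arbitrary sequence of positive integers. Write $p/q=[a_0;a_1,\dots,a_{2k+1}]$ as a finite continued fraction whose last partial quotient has odd index $2k+1$, and let $q_{2k}$ be the denominator of its $2k$th convergent. Suppose $x_1=q>1$, and let $\alpha$ be given by the series $$\alpha=\frac pq-\sum_{j=2}^\infty\frac{(-1)^j}{x_j},$$ where $(x_n)_{n\ge1}$, together with $(y_n)_{n\ge0}$, is defined by $$y_j=y_{j-1}(1+u_jx_j),\qquad x_{j+1}=x_jy_j,\qquad j\ge 1,$$ with $$x_1=q,\qquad y_0=mq+q_{2k}-1,$$ and where the restriction $m\ge1$ is imposed if $q_{2k}=1$. Then the continued fraction expansion of $\alpha$ has the form $\alpha=[a_0;a_1,a_2,\dots]$, where the partial quotients $a_j$ coincide with those of $p/q=[a_0;a_1,\dots,a_{2k+1}]$ for $0\le j\le 2k+1$, while $$a_{2k+2}=m+u_1y_0-1,$$ and $$a_{2k+3j}=1,\qquad a_{2k+3j+1}=x_j-1,\qquad a_{2k+3j+2}=u_{j+1}y_j-1\qquad\text{for all } j\ge 1,$$ with the denominators $q_n$ of the convergents being given by $$q_{2k+3j-2}=x_j,\qquad q_{2k+3j-1}=y_j-x_j+1,\qquad q_{2k+3j}=y_j+1\qquad\text{for all } j\ge1.$$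
   Context: Continued fractions: $[a_0;a_1,\dots,a_n]=a_0+\cfrac{1}{a_1+\cfrac{1}{\cdots+\cfrac1{a_n}}}=p_n/q_n$ with $a_0\in\mathbb Z$, $a_j\in\mathbb Z_{>0}$ for $j\ge1$, and $p_n/q_n$ in lowest terms with $q_n>0$; an infinite continued fraction is $[a_0;a_1,a_2,\dots]=\lim_{n\to\infty}[a_0;a_1,\dots,a_n]$. The numerators and denominators of the convergents $p_n/q_n$ satisfy $p_{n+1}=a_{n+1}p_n+p_{n-1}$, $q_{n+1}=a_{n+1}q_n+q_{n-1}$ for $n\ge -1$, with $p_{-1}=1$, $p_{-2}=0$, $q_{-1}=0$, $q_{-2}=1$. Every rational number has a finite continued fraction whose last index is odd, because $[a_0;\dots,a_j]=[a_0;\dots,a_j-1,1]$ if $j=0$ or $a_j>1$, and $[a_0;\dots,a_{j-1},1]=[a_0;\dots,a_{j-1}+1]$.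
   Formalization: If m=0, u_1=1 and q_{2k}=2 (e.g. 2/3=[0;1,1,1]), then a_{2k+2}=0, so the expansion is not a regular continued fraction; in that case only convergence to α and the q_n given by the recurrence are asserted. *)

theory Defs
  imports Complex_Main
begin

(* [a0; a1, ..., an]; the value at the empty list is a dummy. *)
fun cfrac :: "int list \<Rightarrow> rat" where
  "cfrac [] = 0"
| "cfrac [a] = of_int a"
| "cfrac (a # b # as) = of_int a + 1 / cfrac (b # as)"

(* Only the entries a 0, ..., a n matter. *)
definition convergent_of :: "(nat \<Rightarrow> int) \<Rightarrow> nat \<Rightarrow> rat" where
  "convergent_of a n = cfrac (map a [0..<Suc n])"

(* The denominator of the n-th convergent in lowest terms with positive denominator:
   this is exactly the normalisation of quotient_of. *)
definition cf_denom :: "(nat \<Rightarrow> int) \<Rightarrow> nat \<Rightarrow> int" where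
  "cf_denom a n = snd (quotient_of (convergent_of a n))"

definition cfrac_limit :: "(nat \<Rightarrow> int) \<Rightarrow> real \<Rightarrow> bool" where
  "cfrac_limit a \<alpha> \<longleftrightarrow> (\<lambda>n. real_of_rat (convergent_of a n)) \<longlonglongrightarrow> \<alpha>"

definition is_cfrac_expansion :: "(nat \<Rightarrow> int) \<Rightarrow> real \<Rightarrow> bool" where
  "is_cfrac_expansion a \<alpha> \<longleftrightarrow> (\<forall>j\<ge>1. a j > 0) \<and> cfrac_limit a \<alpha>"

(* The solution of q_{n+1} = a_{n+1} q_n + q_{n-1} with q_{-1} = 0, q_{-2} = 1.  For positive
   a 1, a 2, ... it agrees with cf_denom, but unlike cf_denom it is also the right notion of
   denominator when a partial quotient is 0, where [a0; ..., an] may involve a division by 0. *)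
fun cf_denom_rec :: "(nat \<Rightarrow> int) \<Rightarrow> nat \<Rightarrow> int" where
  "cf_denom_rec a 0 = 1"
| "cf_denom_rec a (Suc 0) = a 1"
| "cf_denom_rec a (Suc (Suc n)) = a (Suc (Suc n)) * cf_denom_rec a (Suc n) + cf_denom_rec a n"

end

theory Submission
  imports Defs
begin

text \<open>
  The recurrence \<open>q\<^sub>n\<^sub>+\<^sub>1 = a\<^sub>n\<^sub>+\<^sub>1 q\<^sub>n + q\<^sub>n\<^sub>-\<^sub>1\<close> turns the prescribed partial quotients
  into the stated denominators. If \<open>n = 2k + 3j - 2\<close>, then \<open>a\<^sub>n\<^sub>+\<^sub>2 = 1\<close> and
  \<open>a\<^sub>n\<^sub>+\<^sub>3 + 1 = x\<^sub>j = q\<^sub>n\<close>, so that \<open>p\<^sub>n\<^sub>+\<^sub>3 q\<^sub>n - p\<^sub>n q\<^sub>n\<^sub>+\<^sub>3 = (-1)\<^sup>j x\<^sub>j\<close>, that is, the convergents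
  of index \<open>n\<close> and \<open>n + 3\<close> differ by \<open>(-1)\<^sup>j / x\<^sub>j\<^sub>+\<^sub>1\<close>: every third convergent is a partial sum
  of the series. The two convergents in between are within \<open>1 / x\<^sub>j\<close> of it.
\<close>

fun cf_num_rec :: "(nat \<Rightarrow> int) \<Rightarrow> nat \<Rightarrow> int" where
  "cf_num_rec a 0 = a 0"
| "cf_num_rec a (Suc 0) = a 1 * a 0 + 1"
| "cf_num_rec a (Suc (Suc n)) = a (Suc (Suc n)) * cf_num_rec a (Suc n) + cf_num_rec a n"

text \<open>The recurrences extend a continued fraction at its end, while \<open>cfrac\<close> peels
  off \<open>a 0\<close> at the front. This lemma and the next restate the recurrences in terms of
  the tail \<open>a \<circ> Suc\<close>, so that inductions can follow \<open>cfrac\<close>.\<close>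

lemma cf_denom_rec_Suc_shift: "cf_denom_rec a (Suc n) = cf_num_rec (a \<circ> Suc) n"
  by (induction n rule: induct_nat_012) (simp_all add: algebra_simps)

lemma cf_num_rec_Suc_shift:
  "cf_num_rec a (Suc n) = a 0 * cf_num_rec (a \<circ> Suc) n + cf_denom_rec (a \<circ> Suc) n"
  by (induction n rule: induct_nat_012) (simp_all add: algebra_simps)

lemma cf_denom_rec_cong:
  "(\<And>j. j \<le> n \<Longrightarrow> a j = b j) \<Longrightarrow> cf_denom_rec a n = cf_denom_rec b n"
  by (induction n rule: induct_nat_012) simp_all

lemma convergent_of_cong:
  "(\<And>j. j \<le> n \<Longrightarrow> a j = b j) \<Longrightarrow> convergent_of a n = convergent_of b n"
  unfolding convergent_of_def by (rule arg_cong[where f = cfrac], rule map_cong) auto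

lemma convergent_of_Suc: "convergent_of a (Suc n) = of_int (a 0) + 1 / convergent_of (a \<circ> Suc) n"
proof -
  have "map a [0..<Suc (Suc n)] = a 0 # map (a \<circ> Suc) [0..<Suc n]"
    by (simp only: map_upt_Suc comp_def)
  moreover have "map (a \<circ> Suc) [0..<Suc n] = a 1 # map (a \<circ> Suc \<circ> Suc) [0..<n]"
    by (simp only: map_upt_Suc comp_def One_nat_def)
  ultimately show ?thesis
    unfolding convergent_of_def by (simp only: cfrac.simps)
qed

text \<open>
  Interior partial quotients may vanish: in the theorem, \<open>a\<^sub>2\<^sub>k\<^sub>+\<^sub>2 = 0\<close> when \<open>m = 0\<close> and \<open>u\<^sub>1 = y\<^sub>0 = 1\<close>.
\<close>

lemma cf_num_rec_pos:
  assumes "\<And>j. j \<le> n \<Longrightarrow> a j \<ge> 0" "a n > 0"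
  shows "cf_num_rec a n > 0"
  using assms
proof (induction n arbitrary: a rule: induct_nat_012)
  case (ge2 n)
  have "cf_num_rec (a \<circ> Suc) (Suc n) > 0" "cf_num_rec (a \<circ> Suc \<circ> Suc) n > 0"
    using ge2.prems by (auto intro!: ge2.IH)
  moreover have "a 0 \<ge> 0"
    using ge2.prems by simp
  ultimately show ?case
    unfolding cf_num_rec_Suc_shift[of a] cf_denom_rec_Suc_shift
    by (intro add_nonneg_pos mult_nonneg_nonneg) auto
qed (simp_all add: add_nonneg_pos)

lemma cf_denom_rec_pos:
  assumes "\<And>j. 1 \<le> j \<Longrightarrow> j \<le> n \<Longrightarrow> a j \<ge> 0" "n \<ge> 1 \<Longrightarrow> a n > 0"
  shows "cf_denom_rec a n > 0"
  using assms by (cases n) (auto simp: cf_denom_rec_Suc_shift intro!: cf_num_rec_pos)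

text \<open>Each step of \<open>cfrac\<close> divides by the convergent of the tail, whose numerator
  is positive by \<open>cf_num_rec_pos\<close>. All tails share the last quotient; were it 0,
  \<open>1 / 0 = 0\<close> would break the identity, as for [1; 0].\<close>

lemma convergent_of_eq:
  assumes "\<And>j. 1 \<le> j \<Longrightarrow> j \<le> n \<Longrightarrow> a j \<ge> 0" "n \<ge> 1 \<Longrightarrow> a n > 0"
  shows "convergent_of a n = of_int (cf_num_rec a n) / of_int (cf_denom_rec a n)"
  using assms
proof (induction n arbitrary: a)
  case 0
  then show ?case by (simp add: convergent_of_def)
next
  case (Suc n)
  have "cf_num_rec (a \<circ> Suc) n > 0"
    using Suc.prems by (intro cf_num_rec_pos) auto
  moreover have "convergent_of (a \<circ> Suc) n
      = of_int (cf_num_rec (a \<circ> Suc) n) / of_int (cf_denom_rec (a \<circ> Suc) n)"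
    using Suc.prems by (intro Suc.IH) auto
  ultimately show ?case
    by (simp add: convergent_of_Suc cf_num_rec_Suc_shift cf_denom_rec_Suc_shift field_simps)
qed

lemma cf_rec_det:
  "cf_num_rec a (Suc n) * cf_denom_rec a n - cf_num_rec a n * cf_denom_rec a (Suc n) = (-1) ^ n"
  by (induction n) (simp_all add: algebra_simps)

lemma cf_rec_det2:
  "cf_num_rec a (n + 2) * cf_denom_rec a n - cf_num_rec a n * cf_denom_rec a (n + 2)
     = (-1) ^ n * a (n + 2)"
  unfolding cf_rec_det[of a n, symmetric] by (simp add: algebra_simps)

text \<open>Expanding index \<open>n + 3\<close> by the recurrence gives \<open>a (n + 3)\<close>
  times the determinant in \<open>cf_rec_det2\<close> plus the one in
  \<open>cf_rec_det\<close>.\<close>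

lemma cf_rec_det3:
  "cf_num_rec a (n + 3) * cf_denom_rec a n - cf_num_rec a n * cf_denom_rec a (n + 3)
     = (-1) ^ n * (a (n + 3) * a (n + 2) + 1)"
  unfolding distrib_left mult.assoc[symmetric] mult.commute[of _ "a (n + 3)"]
  unfolding mult.assoc cf_rec_det2[of a n, symmetric]
  using cf_rec_det[of a n] by (simp add: algebra_simps eval_nat_numeral)

lemma coprime_cf_rec: "coprime (cf_num_rec a n) (cf_denom_rec a n)"
proof (rule coprimeI)
  fix d assume "d dvd cf_num_rec a n" "d dvd cf_denom_rec a n"
  then have "d dvd (-1) ^ n"
    unfolding cf_rec_det[of a n, symmetric] by (intro dvd_diff dvd_mult dvd_mult2)
  then show "is_unit d"
    by (simp add: minus_one_power_iff split: if_splits)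
qed

lemma quotient_of_int_divide:
  assumes "coprime p q" "q > 0"
  shows "quotient_of (of_int p / of_int q) = (p, q)"
  using assms by (metis Fract_of_int_quotient quotient_of_Fract normalize_stable)

text \<open>The pair produced by the recurrences is coprime with positive denominator, so it is the
  normal form that \<open>quotient_of\<close> returns.\<close>

lemma cf_denom_eq:
  assumes "\<And>j. 1 \<le> j \<Longrightarrow> j \<le> n \<Longrightarrow> a j \<ge> 0" "n \<ge> 1 \<Longrightarrow> a n > 0"
  shows "cf_denom a n = cf_denom_rec a n"
proof -
  have "cf_denom_rec a n > 0"
    and "convergent_of a n = of_int (cf_num_rec a n) / of_int (cf_denom_rec a n)"
    using assms by (intro cf_denom_rec_pos convergent_of_eq; auto)+
  then show ?thesis
    unfolding cf_denom_def by (simp add: quotient_of_int_divide coprime_cf_rec)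
qed

theorem theorem2p4:
  fixes p q m :: int and k :: nat
    and u a x y :: "nat \<Rightarrow> int" and \<alpha> :: real
  assumes "coprime p q" and "q > 1" and "m \<ge> 0"
    and "\<forall>n\<ge>1. u n > 0"
    and "\<forall>j\<in>{1..2*k+1}. a j > 0"
    and "of_int p / of_int q = convergent_of a (2*k+1)"
    and "x 1 = q"
    and "y 0 = m * q + cf_denom a (2*k) - 1"
    and "cf_denom a (2*k) = 1 \<longrightarrow> m \<ge> 1"
    and "\<forall>j\<ge>1. y j = y (j - 1) * (1 + u j * x j)"
    and "\<forall>j\<ge>1. x (j + 1) = x j * y j"
    and "\<alpha> = of_int p / of_int q - (\<Sum>i. (-1) ^ (i + 2) / real_of_int (x (i + 2)))"
  shows "summable (\<lambda>i. (-1) ^ (i + 2) / real_of_int (x (i + 2))) \<and>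
    (\<exists>b :: nat \<Rightarrow> int.
      (\<forall>j\<le>2*k+1. b j = a j) \<and>
      b (2*k+2) = m + u 1 * y 0 - 1 \<and>
      (\<forall>j\<ge>1. b (2*k+3*j) = 1 \<and>
              b (2*k+3*j+1) = x j - 1 \<and>
              b (2*k+3*j+2) = u (j + 1) * y j - 1) \<and>
      (m + u 1 * y 0 - 1 \<noteq> 0 \<longrightarrow>
         is_cfrac_expansion b \<alpha> \<and>
         (\<forall>j\<ge>1. cf_denom b (2*k+3*j-2) = x j \<and>
                 cf_denom b (2*k+3*j-1) = y j - x j + 1 \<and>
                 cf_denom b (2*k+3*j) = y j + 1)) \<and>
      (m + u 1 * y 0 - 1 = 0 \<longrightarrow>
         cfrac_limit b \<alpha> \<and>
         (\<forall>j\<ge>1. cf_denom_rec b (2*k+3*j-2) = x j \<and>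
                 cf_denom_rec b (2*k+3*j-1) = y j - x j + 1 \<and>
                 cf_denom_rec b (2*k+3*j) = y j + 1)))"
proof -

  \<comment> \<open>The finite expansion of p/q\<close>
  let ?f = "\<lambda>i. (-1) ^ (i + 2) / real_of_int (x (i + 2))"
  have a_pos: "a j > 0" if "1 \<le> j" "j \<le> 2*k+1" for j
    using assms(5) that by simp
  have denom_a: "cf_denom a n = cf_denom_rec a n" "cf_denom_rec a n > 0" if "n \<le> 2*k+1" for n
    using that a_pos less_imp_le[OF a_pos] by (intro cf_denom_eq cf_denom_rec_pos; force)+
  have denom_a_last: "cf_denom_rec a (2*k+1) = q"
  proof -
    have "cf_denom a (2*k+1) = q"
      unfolding cf_denom_def assms(6)[symmetric]
      using assms(1,2) by (simp add: quotient_of_int_divide)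
    then show ?thesis using denom_a by simp
  qed

  \<comment> \<open>Growth of x and y\<close>
  have y_Suc: "y (Suc j) = y j * (1 + u (Suc j) * x (Suc j))" for j
    using assms(10) by simp
  have x_Suc: "x (Suc (Suc j)) = x (Suc j) * y (Suc j)" for j
    using assms(11) by simp
  \<comment> \<open>The restriction \<open>m \<ge> 1\<close> for \<open>cf_denom a (2*k) = 1\<close>
    enters here: \<open>y 0 = 0\<close> would make every \<open>y j\<close> vanish.\<close>
  have y0: "y 0 \<ge> 1"
  proof (cases "cf_denom a (2*k) = 1")
    case True
    then have "m * q \<ge> 1 * 1"
      using assms(2,9) by (intro mult_mono) auto
    then show ?thesis using assms(8) True by simp
  next
    case False
    then have "cf_denom a (2*k) \<ge> 2" using denom_a[of "2*k"] by simp
    moreover have "m * q \<ge> 0" using assms(2,3) by simp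
    ultimately show ?thesis using assms(8) by simp
  qed
  have grow: "y (Suc j) \<ge> 1 + x (Suc j)" if "x (Suc j) \<ge> 0" "y j \<ge> 1" for j
  proof -
    have "u (Suc j) * x (Suc j) \<ge> 1 * x (Suc j)"
      using assms(4) that by (intro mult_right_mono) (auto simp: int_one_le_iff_zero_less)
    moreover from this have "y j * (1 + u (Suc j) * x (Suc j)) \<ge> 1 * (1 + u (Suc j) * x (Suc j))"
      using that by (intro mult_right_mono) auto
    ultimately show ?thesis unfolding y_Suc by simp
  qed
  \<comment> \<open>The bound on \<open>y j\<close> is carried along because \<open>grow\<close>
    then yields \<open>y (Suc j) \<ge> 2\<close>, so that \<open>x\<close> at least doubles.\<close>
  have xy: "x (Suc j) \<ge> 2 ^ Suc j \<and> y j \<ge> 1" for j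
  proof (induction j)
    case 0
    then show ?case using assms(2,7) y0 by simp
  next
    case (Suc j)
    have "x (Suc j) \<ge> 1" using Suc one_le_power[of "2::int" "Suc j"] by linarith
    with Suc grow[of j] have "y (Suc j) \<ge> 2" by auto
    moreover from this have "x (Suc j) * y (Suc j) \<ge> 2 ^ Suc j * 2"
      using Suc \<open>x (Suc j) \<ge> 1\<close> by (intro mult_mono) auto
    ultimately show ?case by (simp add: x_Suc)
  qed
  have x_ge: "x (Suc j) \<ge> 2" for j
    using xy[of j] self_le_power[of "2::int" "Suc j"] by linarith
  have y_ge: "y (Suc j) \<ge> 1 + x (Suc j)" for j
    using grow[of j] xy[of j] x_ge[of j] by simp

  \<comment> \<open>Geometric decay of 1/x and summability\<close>
  have inv_x_le: "1 / real_of_int (x (Suc j)) \<le> (1/2) ^ j" for j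
  proof -
    have "2 ^ j \<le> x (Suc j)"
      using xy[of j] zero_le_power[of "2::int" j] unfolding power_Suc by linarith
    then have "2 ^ j \<le> real_of_int (x (Suc j))"
      by (metis of_int_le_iff of_int_numeral of_int_power)
    then show ?thesis unfolding power_one_over by (intro frac_le) simp_all
  qed
  have inv_x_lim: "(\<lambda>j. 1 / real_of_int (x (Suc j))) \<longlonglongrightarrow> 0"
  proof (rule tendsto_0_le)
    show "(\<lambda>j. (1/2) ^ j :: real) \<longlonglongrightarrow> 0" by (rule LIMSEQ_realpow_zero) auto
    \<comment> \<open>The factor 1 is the constant in the bound that \<open>tendsto_0_le\<close>
      expects.\<close>
    have "norm (1 / real_of_int (x (Suc j))) \<le> norm ((1/2) ^ j :: real) * 1" for j
      using inv_x_le[of j] x_ge[of j] by simp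
    then show "\<forall>\<^sub>F j in sequentially.
        norm (1 / real_of_int (x (Suc j))) \<le> norm ((1/2) ^ j :: real) * 1"
      by (intro always_eventually allI)
  qed
  have summable: "summable ?f"
  proof (rule summable_comparison_test')
    show "summable (\<lambda>i. (1/2) ^ Suc i :: real)"
      unfolding summable_Suc_iff by (rule summable_geometric) simp
    show "norm (?f i) \<le> (1/2) ^ Suc i" for i
      using inv_x_le[of "Suc i"] x_ge[of "Suc i"] by (simp add: norm_divide norm_power)
  qed

  \<comment> \<open>The partial quotients and their signs\<close>
  define b where "b n =
    (if n \<le> 2*k+1 then a n else if n = 2*k+2 then m + u 1 * y 0 - 1
     else (let j = (n - 2*k) div 3; r = (n - 2*k) mod 3 in
       if r = 0 then 1 else if r = 1 then x j - 1 else u (j + 1) * y j - 1))" for n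
  have b_init: "b j = a j" if "j \<le> 2*k+1" for j
    using that by (simp add: b_def)
  have b2: "b (2*k+2) = m + u 1 * y 0 - 1"
    by (simp add: b_def)
  have b_per: "b (2*k+3*j) = 1" "b (2*k+3*j+1) = x j - 1" "b (2*k+3*j+2) = u (j + 1) * y j - 1"
    if "j \<ge> 1" for j
  proof -
    have sub: "2*k+3*j+r - 2*k = 3*j+r" for r by simp
    have div: "(3*j+r) div 3 = j" "(3*j+r) mod 3 = r" if "r < 3" for r
      using that by simp_all
    have "b (2*k+3*j+r) = (if r = 0 then 1 else if r = 1 then x j - 1 else u (j + 1) * y j - 1)"
      if "r < 3" for r
      using \<open>j \<ge> 1\<close> unfolding b_def Let_def sub div[OF that] by simp
    from this[of 0] this[of 1] this[of 2]
    show "b (2*k+3*j) = 1" "b (2*k+3*j+1) = x j - 1" "b (2*k+3*j+2) = u (j + 1) * y j - 1"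
      by simp_all
  qed
  have u_pos: "u (Suc j) \<ge> 1" for j
    using assms(4) by (simp add: int_one_le_iff_zero_less)
  have b2_nonneg: "b (2*k+2) \<ge> 0"
    using mult_mono[of 1 "u 1" 1 "y 0"] u_pos[of 0] y0 assms(3) unfolding b2 by simp
  have b_pos: "b n > 0" if "n \<ge> 1" "n \<noteq> 2*k+2" for n
  proof (cases "n \<le> 2*k+1")
    case True
    then show ?thesis using that a_pos b_init by simp
  next
    case False
    \<comment> \<open>The periodic pattern starts at block 1, so the block number is written as
      \<open>Suc i\<close>.\<close>
    define i where "i = (n - 2*k) div 3 - 1"
    from False that have "n - 2*k \<ge> 3" by simp
    then have "n = 2*k+3*Suc i \<or> n = 2*k+3*Suc i+1 \<or> n = 2*k+3*Suc i+2"
      unfolding i_def by presburger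
    \<comment> \<open>Strictness comes from
      \<open>y (Suc i) \<ge> 1 + x (Suc i) \<ge> 3\<close>.\<close>
    moreover have "u (Suc i + 1) * y (Suc i) > 1"
      using mult_mono[of 1 "u (Suc i + 1)" 2 "y (Suc i)"] u_pos[of "Suc i"] y_ge[of i] x_ge[of i]
      by simp
    ultimately show ?thesis
      using b_per[of "Suc i"] x_ge[of i] by (elim disjE) simp_all
  qed
  have b_nonneg: "b n \<ge> 0" if "n \<ge> 1" for n
    using that b_pos[of n] b2_nonneg by (cases "n = 2*k+2") auto

  \<comment> \<open>Denominators from the recurrence\<close>
  have denom_b_init: "cf_denom_rec b n = cf_denom_rec a n" if "n \<le> 2*k+1" for n
    using that b_init by (intro cf_denom_rec_cong) auto
  \<comment> \<open>Passing the indices as equations lets the recurrence apply to sums that are not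
    literally of the form \<open>Suc (Suc n)\<close>.\<close>
  have rec: "cf_denom_rec b l = b l * cf_denom_rec b n' + cf_denom_rec b n"
    if "n' = n + 1" "l = n + 2" for n n' l
    using that by simp
  have denoms: "cf_denom_rec b (2*k+3*j+1) = x (Suc j) \<and>
      cf_denom_rec b (2*k+3*j+2) = y (Suc j) - x (Suc j) + 1 \<and>
      cf_denom_rec b (2*k+3*j+3) = y (Suc j) + 1" for j
  proof (induction j)
    case 0
    have 1: "cf_denom_rec b (2*k+1) = q"
      using denom_b_init denom_a_last by simp
    have "cf_denom_rec b (2*k+2) = b (2*k+2) * cf_denom_rec b (2*k+1) + cf_denom_rec b (2*k)"
      by (rule rec) simp_all
    \<comment> \<open>The choice of \<open>y 0\<close> makes m q plus the denominator of index 2k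
      equal to \<open>y 0 + 1\<close>; the remaining terms are
      \<open>u 1 * y 0 * q - q\<close>.\<close>
    also have "\<dots> = y 1 - x 1 + 1"
      using 1 denom_b_init[of "2*k"] denom_a(1)[of "2*k"] assms(7,8) y_Suc[of 0]
      unfolding b2 by (simp add: algebra_simps)
    finally have 2: "cf_denom_rec b (2*k+2) = y 1 - x 1 + 1" .
    have "cf_denom_rec b (2*k+3)
        = b (2*k+3) * cf_denom_rec b (2*k+2) + cf_denom_rec b (2*k+1)"
      by (rule rec) simp_all
    then have 3: "cf_denom_rec b (2*k+3) = y 1 + 1"
      using b_per(1)[of 1] 1 2 assms(7) by (simp del: cf_denom_rec.simps)
    show ?case
      using 1 2 3 assms(7) by (simp del: cf_denom_rec.simps)
  next
    case (Suc j)
    let ?n = "2*k+3*Suc j"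
    have idx: "?n = 2*k+3*j+3" and ge: "Suc j \<ge> 1" by simp_all
    have IH: "cf_denom_rec b (2*k+3*j+2) = y (Suc j) - x (Suc j) + 1"
        "cf_denom_rec b ?n = y (Suc j) + 1"
      using Suc unfolding idx by blast+
    have "cf_denom_rec b (?n+1)
        = b (?n+1) * cf_denom_rec b ?n + cf_denom_rec b (2*k+3*j+2)"
      by (rule rec) simp_all
    \<comment> \<open>With X = \<open>x (Suc j)\<close> and Y = \<open>y (Suc j)\<close>, this is (X
      - 1)(Y + 1) + (Y - X + 1) = X Y.\<close>
    also have "\<dots> = x (Suc (Suc j))"
      unfolding b_per(2)[OF ge] IH x_Suc by (simp add: algebra_simps)
    finally have 1: "cf_denom_rec b (?n+1) = x (Suc (Suc j))" .
    have "cf_denom_rec b (?n+2) = b (?n+2) * cf_denom_rec b (?n+1) + cf_denom_rec b ?n"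
      by (rule rec) simp_all
    also have "\<dots> = y (Suc (Suc j)) - x (Suc (Suc j)) + 1"
      unfolding b_per(3)[OF ge] IH 1 y_Suc[of "Suc j"] by (simp add: algebra_simps)
    finally have 2: "cf_denom_rec b (?n+2) = y (Suc (Suc j)) - x (Suc (Suc j)) + 1" .
    have "cf_denom_rec b (?n+3) = b (?n+3) * cf_denom_rec b (?n+2) + cf_denom_rec b (?n+1)"
      by (rule rec) simp_all
    moreover have "b (?n+3) = 1"
      using b_per(1)[of "Suc (Suc j)"] by (simp add: algebra_simps)
    ultimately have "cf_denom_rec b (?n+3) = y (Suc (Suc j)) + 1"
      unfolding 1 2 by simp
    with 1 2 show ?case by blast
  qed

  \<comment> \<open>Every third convergent as a partial sum\<close>
  define C where "C n = real_of_int (cf_num_rec b n) / real_of_int (cf_denom_rec b n)" for n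
  \<comment> \<open>At index 2k+2 the last quotient may be 0, and \<open>convergent_of\<close> may
    then differ from \<open>C\<close>. A single index does not affect the limit.\<close>
  have conv: "real_of_rat (convergent_of b n) = C n" if "n \<noteq> 2*k+2" for n
    using b_nonneg b_pos that
    by (subst convergent_of_eq) (auto simp: C_def of_rat_divide)
  have C_diff: "C n' - C n = real_of_int (cf_num_rec b n' * cf_denom_rec b n
        - cf_num_rec b n * cf_denom_rec b n')
        / (real_of_int (cf_denom_rec b n') * real_of_int (cf_denom_rec b n))"
    if "cf_denom_rec b n \<noteq> 0" "cf_denom_rec b n' \<noteq> 0" for n n'
    using that by (simp add: C_def field_simps)
  have b_mid: "b (2*k+3*j+3) = 1" "b (2*k+3*j+4) = x (Suc j) - 1" for j
    using b_per(1,2)[of "Suc j"] by (simp_all add: algebra_simps)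
  have C_step: "C (2*k+3*Suc j+1) = C (2*k+3*j+1) - ?f j" for j
  proof -
    let ?n = "2*k+3*j+1"
    have eq: "?n+3 = 2*k+3*Suc j+1" "?n+3 = 2*k+3*j+4" "?n+2 = 2*k+3*j+3" by simp_all
    have b: "b (?n+2) = 1" "b (?n+3) = x (Suc j) - 1"
      unfolding eq(2,3) by (rule b_mid)+
    have d: "cf_denom_rec b (?n+3) = x (Suc (Suc j))" "cf_denom_rec b ?n = x (Suc j)"
      unfolding eq(1) using denoms by blast+
    \<comment> \<open>The exponent is \<open>2*k+3*j+1\<close>, and \<open>3*j\<close> has the
      parity of \<open>j\<close>.\<close>
    have "(-1) ^ ?n = - ((-1) ^ j :: int)"
      by (simp add: power_add power_mult)
    then have "cf_num_rec b (?n+3) * cf_denom_rec b ?n - cf_num_rec b ?n * cf_denom_rec b (?n+3)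
        = - ((-1) ^ j) * x (Suc j)"
      unfolding cf_rec_det3 b by simp
    moreover have "x (Suc j) > 0" "x (Suc (Suc j)) > 0"
      using x_ge[of j] x_ge[of "Suc j"] by simp_all
    ultimately have "C (?n+3) - C ?n = - ((-1) ^ j) * x (Suc j) / (x (Suc (Suc j)) * x (Suc j))"
      by (subst C_diff) (simp_all only: d, simp_all)
    also have "\<dots> = - ?f j"
      using \<open>x (Suc j) > 0\<close> by simp
    finally show ?thesis unfolding eq(1) by simp
  qed
  have C_base: "C (2*k+1) = of_int p / of_int q"
  proof -
    have "C (2*k+1) = real_of_rat (convergent_of a (2*k+1))"
      using conv[of "2*k+1"] convergent_of_cong[of "2*k+1" b a] b_init by simp
    then show ?thesis unfolding assms(6)[symmetric] by (simp add: of_rat_divide)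
  qed
  have C_sum: "C (2*k+3*j+1) = of_int p / of_int q - (\<Sum>i<j. ?f i)" for j
  proof (induction j)
    case 0
    then show ?case using C_base by simp
  next
    case (Suc j)
    then show ?case unfolding C_step by simp
  qed
  have C_lim: "(\<lambda>j. C (2*k+3*j+1)) \<longlonglongrightarrow> \<alpha>"
    unfolding C_sum assms(12) by (intro tendsto_intros summable_LIMSEQ summable)

  \<comment> \<open>The convergents in between and the limit\<close>
  have frac_bound: "\<bar>real_of_int N / (real_of_int A * real_of_int B)\<bar> \<le> 1 / real_of_int B"
    if "\<bar>N\<bar> \<le> 1" "A \<ge> 1" "B \<ge> 1" for N A B
  proof -
    have "\<bar>real_of_int N\<bar> / (real_of_int A * real_of_int B) \<le> 1 / (1 * real_of_int B)"
      using that by (intro frac_le mult_right_mono) auto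
    then show ?thesis using that by (simp add: abs_mult)
  qed
  \<comment> \<open>For r = 1 the determinant is a sign; for r = 2 it is a sign times
    \<open>b (2*k+3*j+3) = 1\<close>. Since \<open>C\<close> comes from the recurrences, index 2k+2
    is covered too.\<close>
  have C_near: "\<bar>C (2*k+3*j+1+r) - C (2*k+3*j+1)\<bar> \<le> 1 / real_of_int (x (Suc j))" if "r < 3" for j r
  proof -
    let ?n = "2*k+3*j+1"
    have eq: "?n+1 = 2*k+3*j+2" "?n+2 = 2*k+3*j+3" by simp_all
    have d: "cf_denom_rec b ?n = x (Suc j)"
      using denoms by blast
    consider "r = 0" | "r = 1" | "r = 2" using \<open>r < 3\<close> by linarith
    then have near: "\<bar>cf_num_rec b (?n+r) * cf_denom_rec b ?n - cf_num_rec b ?n * cf_denom_rec b (?n+r)\<bar> \<le> 1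
        \<and> cf_denom_rec b (?n+r) \<ge> 1"
    proof cases
      case 1
      then show ?thesis using d x_ge[of j] by simp
    next
      case 2
      have "cf_denom_rec b (?n+1) \<ge> 1"
        unfolding eq using denoms[of j] y_ge[of j] by linarith
      then show ?thesis
        using cf_rec_det[of b ?n] unfolding 2 Suc_eq_plus1 by (simp only: power_abs) simp
    next
      case 3
      have "b (?n+2) = 1"
        unfolding eq by (rule b_mid)
      moreover have "cf_denom_rec b (?n+2) \<ge> 1"
        unfolding eq using denoms[of j] y_ge[of j] x_ge[of j] by linarith
      ultimately show ?thesis
        unfolding 3 cf_rec_det2 by (simp only: mult_1_right power_abs) simp
    qed
    from near have "\<bar>real_of_int (cf_num_rec b (?n+r) * cf_denom_rec b ?n
          - cf_num_rec b ?n * cf_denom_rec b (?n+r))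
        / (real_of_int (cf_denom_rec b (?n+r)) * real_of_int (cf_denom_rec b ?n))\<bar>
        \<le> 1 / real_of_int (x (Suc j))"
      unfolding d using x_ge[of j] by (intro frac_bound) auto
    moreover have "cf_denom_rec b (?n+r) \<noteq> 0" "cf_denom_rec b ?n \<noteq> 0"
      using near x_ge[of j] unfolding d by auto
    ultimately show ?thesis
      by (subst C_diff)
  qed
  have "(\<lambda>n. C (n + (2*k+1))) \<longlonglongrightarrow> \<alpha>"
  proof -
    \<comment> \<open>Writing n as 3 (n div 3) + n mod 3 compares each convergent with the partial
      sum of its block, whose index also tends to infinity.\<close>
    have div3: "filterlim (\<lambda>n::nat. n div 3) sequentially sequentially"
      unfolding filterlim_at_top eventually_sequentially
      by (metis div_le_mono nonzero_mult_div_cancel_left zero_neq_numeral)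
    have near: "\<bar>C (n + (2*k+1)) - C (2*k+3*(n div 3)+1)\<bar> \<le> 1 / real_of_int (x (Suc (n div 3)))" for n
    proof -
      have "n + (2*k+1) = 2*k+3*(n div 3)+1 + n mod 3" by presburger
      then show ?thesis using C_near[of "n mod 3" "n div 3"] by simp
    qed
    have "norm (C (n + (2*k+1)) - C (2*k+3*(n div 3)+1))
        \<le> norm (1 / real_of_int (x (Suc (n div 3)))) * 1" for n
      unfolding real_norm_def mult_1_right by (rule order_trans[OF near abs_ge_self])
    then have "(\<lambda>n. C (n + (2*k+1)) - C (2*k+3*(n div 3)+1)) \<longlonglongrightarrow> 0"
      by (intro tendsto_0_le[OF filterlim_compose[OF inv_x_lim div3]] always_eventually allI)
    from tendsto_add[OF this filterlim_compose[OF C_lim div3]] show ?thesis by simp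
  qed
  then have "C \<longlonglongrightarrow> \<alpha>" by (rule LIMSEQ_offset)
  moreover have "\<forall>\<^sub>F n in sequentially. real_of_rat (convergent_of b n) = C n"
    using eventually_gt_at_top[of "2*k+2"] by eventually_elim (simp add: conv)
  ultimately have limit: "cfrac_limit b \<alpha>"
    unfolding cfrac_limit_def by (simp add: tendsto_cong)

  \<comment> \<open>Reindexing and the two cases of the conclusion\<close>
  have denoms': "cf_denom_rec b (2*k+3*j-2) = x j \<and>
                 cf_denom_rec b (2*k+3*j-1) = y j - x j + 1 \<and>
                 cf_denom_rec b (2*k+3*j) = y j + 1" if "j \<ge> 1" for j
  proof -
    obtain i where "j = Suc i" using \<open>j \<ge> 1\<close> by (cases j) auto
    then have "2*k+3*j-2 = 2*k+3*i+1" "2*k+3*j-1 = 2*k+3*i+2" "2*k+3*j = 2*k+3*i+3" by simp_all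
    then show ?thesis using denoms[of i] \<open>j = Suc i\<close> by metis
  qed
  \<comment> \<open>A nonzero quotient at 2k+2 is positive, so all quotients from index 1 on are,
    and \<open>cf_denom_eq\<close> applies at every index.\<close>
  have "is_cfrac_expansion b \<alpha> \<and> cf_denom b = cf_denom_rec b" if "m + u 1 * y 0 - 1 \<noteq> 0"
  proof -
    have pos: "b j > 0" if "j \<ge> 1" for j
      using that \<open>m + u 1 * y 0 - 1 \<noteq> 0\<close> b_pos[of j] b2_nonneg unfolding b2
      by (cases "j = 2*k+2") (simp_all only: b2, simp)
    then have "cf_denom b = cf_denom_rec b"
      by (intro ext cf_denom_eq) (auto intro: less_imp_le)
    with pos limit show ?thesis
      unfolding is_cfrac_expansion_def by blast
  qed
  then show ?thesis
    using b_init b2 b_per denoms' limit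
    by (intro conjI[OF summable] exI[of _ b] conjI impI allI) (simp_all only: simp_thms)
qed

end
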